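(* Let $\mathcal{U}$ be finite with cardinality at least $n+1$. Let $\mathcal{X}=\mathbb{R}^n$ and $\varepsilon\in\mathbb{R}$. Suppose that $(\mathrm{Rec}(\varepsilon))$ attains its optimum at some $x^*\in\mathbb{R}^n$, and that for each $\xi\in\mathcal{U}$ the functions $F(\cdot,\xi)$ (componentwise) and $f(\cdot,\xi)$ are quasiconvex. Let the metric $d$ be convex. Then there exists a subset $\overline{\mathcal{U}}\subseteq\mathcal{U}$ of scenarios with $2\le|\overline{\mathcal{U}}|\le n+1$ such that $$r_\varepsilon^*(\mathcal{U})=r_\varepsilon(x^*,\mathcal{U})=r_\varepsilon(x^*,\overline{\mathcal{U}})=r_\varepsilon^*(\overline{\mathcal{U}}).$$
   Context: Uncertain problem $(\mathrm{P}(\xi),\xi\in\mathcal{U})$: $\mathcal{X}\subseteq\mathbb{R}^n$ is closed, $\mathcal{U}\subseteq\mathbb{R}^M$ is a closed set with at least two elements, and for each $\xi\in\mathcal{U}$ the functions $F(\cdot,\xi):\mathbb{R}^n\to\mathbb{R}^m$ and $f(\cdot,\xi):\mathbb{R}^n\to\mathbb{R}$ are continuous. $\mathrm{P}(\xi)$ is: minimize $f(x,\xi)$ subject to $F(x,\xi)\le 0$ (componentwise), $x\in\mathcal{X}$. Further, $d:\mathbb{R}^n\times\mathbb{R}^n\to\mathbb{R}$ is a metric; "$d$ convex" means convex as a function on $\mathbb{R}^n\times\mathbb{R}^n$. Let $\mathcal{G}_\varepsilon(\xi)=\{y\in\mathcal{X}: F(y,\xi)\le 0,\ f(y,\xi)\le\varepsilon\}$,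 $d(x,\mathcal{G}_\varepsilon(\xi))=\min_{y\in\mathcal{G}_\varepsilon(\xi)}d(x,y)$ with $d(x,\emptyset):=\infty$. For a nonempty set $\mathcal{V}\subseteq\mathcal{U}$ let $r_\varepsilon(x,\mathcal{V})=\sup_{\xi\in\mathcal{V}}d(x,\mathcal{G}_\varepsilon(\xi))$ and let $r_\varepsilon^*(\mathcal{V})$ denote the best possible value of $r_\varepsilon(x,\mathcal{V})$ over $x\in\mathcal{X}$. $(\mathrm{Rec}(\varepsilon))$ is the problem of minimizing $r_\varepsilon(x,\mathcal{U})$ over $x\in\mathcal{X}$. Standing assumption: the optimal value of $(\mathrm{Rec}(\varepsilon))$ is finite. *)

theory Defs
  imports "HOL-Analysis.Analysis"
begin

definition quasiconvex_on :: "'a::real_vector set \<Rightarrow> ('a \<Rightarrow> real) \<Rightarrow> bool" where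
  "quasiconvex_on S g \<longleftrightarrow> convex S \<and>
     (\<forall>x\<in>S. \<forall>y\<in>S. \<forall>t\<in>{0..1}. g ((1 - t) *\<^sub>R x + t *\<^sub>R y) \<le> max (g x) (g y))"

definition good_set ::
  "(real^'n) set \<Rightarrow> (real^'n \<Rightarrow> real^'k \<Rightarrow> real^'m) \<Rightarrow> (real^'n \<Rightarrow> real^'k \<Rightarrow> real)
     \<Rightarrow> real \<Rightarrow> real^'k \<Rightarrow> (real^'n) set" where
  "good_set X F f \<epsilon> \<xi> = {y \<in> X. (\<forall>i. F y \<xi> $ i \<le> 0) \<and> f y \<xi> \<le> \<epsilon>}"

(* Extended reals, so that the distance to the empty set is \<infinity>. The infimum is a minimum
   when A is nonempty and closed and d is a metric that is convex on the product space. *)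
definition dist_to_set ::
  "(real^'n \<Rightarrow> real^'n \<Rightarrow> real) \<Rightarrow> real^'n \<Rightarrow> (real^'n) set \<Rightarrow> ereal" where
  "dist_to_set d x A = (INF y\<in>A. ereal (d x y))"

definition recovery_cost ::
  "(real^'n) set \<Rightarrow> (real^'n \<Rightarrow> real^'k \<Rightarrow> real^'m) \<Rightarrow> (real^'n \<Rightarrow> real^'k \<Rightarrow> real)
     \<Rightarrow> (real^'n \<Rightarrow> real^'n \<Rightarrow> real) \<Rightarrow> real \<Rightarrow> real^'n \<Rightarrow> (real^'k) set \<Rightarrow> ereal" where
  "recovery_cost X F f d \<epsilon> x V = (SUP \<xi>\<in>V. dist_to_set d x (good_set X F f \<epsilon> \<xi>))"

definition opt_recovery_cost ::
  "(real^'n) set \<Rightarrow> (real^'n \<Rightarrow> real^'k \<Rightarrow> real^'m) \<Rightarrow> (real^'n \<Rightarrow> real^'k \<Rightarrow> real)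
     \<Rightarrow> (real^'n \<Rightarrow> real^'n \<Rightarrow> real) \<Rightarrow> real \<Rightarrow> (real^'k) set \<Rightarrow> ereal" where
  "opt_recovery_cost X F f d \<epsilon> V = (INF x\<in>X. recovery_cost X F f d \<epsilon> x V)"

end

theory Submission
  imports Defs
begin

text \<open>
  Let \<open>r\<close> be the optimal value. The strict sublevel sets of the functions
  \<open>x \<mapsto> d(x, G(\<xi>))\<close> at level \<open>r\<close> are convex and, since \<open>r\<close> is optimal, have no common point. By Helly's
  theorem some \<open>n + 1\<close> of them already have no common point; the corresponding scenarios
  admit no value below \<open>r\<close>, while \<open>x\<^sup>*\<close> attains at most \<open>r\<close> on them.
\<close>

lemma convex_sublevel_quasiconvex:
  assumes "quasiconvex_on S g"
  shows "convex {x \<in> S. g x \<le> c}"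
  unfolding convex_alt
proof clarsimp
  fix x y and t :: real
  assume H: "x \<in> S" "g x \<le> c" "y \<in> S" "g y \<le> c" "0 \<le> t" "t \<le> 1"
  have "g ((1 - t) *\<^sub>R x + t *\<^sub>R y) \<le> max (g x) (g y)"
    using assms H unfolding quasiconvex_on_def by simp
  then show "(1 - t) *\<^sub>R x + t *\<^sub>R y \<in> S \<and> g ((1 - t) *\<^sub>R x + t *\<^sub>R y) \<le> c"
    using assms H unfolding quasiconvex_on_def convex_alt by force
qed

text \<open>Quasiconvexity makes each constraint a convex sublevel set, and the good set is the
  intersection of these with \<open>X\<close>.\<close>

lemma convex_good_set:
  assumes "convex X"
    and "\<And>i. quasiconvex_on UNIV (\<lambda>x. F x \<xi> $ i)"
    and "quasiconvex_on UNIV (\<lambda>x. f x \<xi>)"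
  shows "convex (good_set X F f \<epsilon> \<xi>)"
proof -
  have "good_set X F f \<epsilon> \<xi> = X \<inter> (\<Inter>i. {x \<in> UNIV. F x \<xi> $ i \<le> 0}) \<inter> {x \<in> UNIV. f x \<xi> \<le> \<epsilon>}"
    unfolding good_set_def by auto
  then show ?thesis
    using convex_sublevel_quasiconvex[OF assms(2)] convex_sublevel_quasiconvex[OF assms(3)] assms(1)
    by (simp only:) (intro convex_Int convex_INT)
qed

lemma dist_to_set_less_iff: "dist_to_set d x A < c \<longleftrightarrow> (\<exists>y\<in>A. ereal (d x y) < c)"
  unfolding dist_to_set_def by (rule INF_less_iff)

text \<open>A strict bound on an infimum always has a witness in \<open>A\<close>, so attainment is
  never at issue. Witnesses for two points are combined with the same weights as the points; joint
  convexity of \<open>d\<close> controls the resulting distance.\<close>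

lemma convex_dist_to_set_less:
  assumes d: "convex_on UNIV (\<lambda>(x, y). d x y)" and A: "convex A"
  shows "convex {x. dist_to_set d x A < c}"
  unfolding convex_alt dist_to_set_less_iff
proof clarsimp
  fix x1 y1 x2 y2 and t :: real
  assume H: "y1 \<in> A" "ereal (d x1 y1) < c" "y2 \<in> A" "ereal (d x2 y2) < c" "0 \<le> t" "t \<le> 1"
  let ?x = "(1 - t) *\<^sub>R x1 + t *\<^sub>R x2" and ?y = "(1 - t) *\<^sub>R y1 + t *\<^sub>R y2"
  have "d ?x ?y \<le> (1 - t) * d x1 y1 + t * d x2 y2"
    using convex_onD[OF d H(5,6), of "(x1, y1)" "(x2, y2)"] by simp
  \<comment> \<open>The level \<open>c\<close> may be infinite, so the estimate goes through the
    larger of two real distances rather than a convex combination involving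
    \<open>c\<close>.\<close>
  also have "\<dots> \<le> max (d x1 y1) (d x2 y2)"
    using H(5,6) by (intro convex_bound_le) auto
  finally have "ereal (d ?x ?y) \<le> ereal (max (d x1 y1) (d x2 y2))"
    by (simp only: ereal_less_eq(3))
  also have "\<dots> < c"
    using H(2,4) by simp
  finally show "\<exists>y\<in>A. ereal (d ?x y) < c"
    using A H unfolding convex_alt by blast
qed

text \<open>Helly's theorem concerns a set of sets, where indices with equal \<open>S i\<close>
  collapse. This version counts indices instead, as scenarios have to be counted.\<close>

lemma helly_indexed:
  fixes S :: "'i \<Rightarrow> 'a::euclidean_space set"
  assumes fin: "finite I" and card: "card I \<ge> DIM('a) + 1"
    and conv: "\<And>i. i \<in> I \<Longrightarrow> convex (S i)"
    and empty: "(\<Inter>i\<in>I. S i) = {}"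
  obtains J where "J \<subseteq> I" "card J = DIM('a) + 1" "(\<Inter>i\<in>J. S i) = {}"
proof -
  have "\<exists>T \<subseteq> S ` I. card T \<le> DIM('a) + 1 \<and> \<Inter>T = {}"
  \<comment> \<open>After collapsing, the image may have too few members for Helly; then it is
    itself small enough to serve as \<open>T\<close>.\<close>
  proof (cases "card (S ` I) \<ge> DIM('a) + 1")
    case True
    have "\<exists>T \<subseteq> S ` I. card T = DIM('a) + 1 \<and> \<Inter>T = {}"
      using Helly[OF True] conv empty by blast
    then show ?thesis
      by (metis order_refl)
  next
    case False
    then show ?thesis
      using empty by (intro exI[of _ "S ` I"]) simp
  qed
  then obtain T where T: "T \<subseteq> S ` I" "card T \<le> DIM('a) + 1" "\<Inter>T = {}"
    by blast
  \<comment> \<open>One index is chosen for each member of \<open>T\<close>, so \<open>K\<close> is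
    no larger than \<open>T\<close>.\<close>
  obtain K where K: "K \<subseteq> I" "inj_on S K" "T = S ` K"
    using T(1) by (meson subset_image_inj)
  have "card K \<le> DIM('a) + 1"
    using T(2) K(2,3) by (simp add: card_image)
  \<comment> \<open>Padding with further indices reaches the exact size, and can only shrink the
    intersection.\<close>
  then obtain J where J: "K \<subseteq> J" "J \<subseteq> I" "card J = DIM('a) + 1"
    using exists_subset_between[OF _ card K(1) fin] by blast
  have "(\<Inter>i\<in>J. S i) \<subseteq> \<Inter>T"
    unfolding K(3) using J(1) by (intro INF_superset_mono) auto
  with T(3) J(2,3) show thesis
    by (intro that) auto
qed

theorem theorem2:
  fixes U :: "(real^'k) set"
    and F :: "real^'n \<Rightarrow> real^'k \<Rightarrow> real^'m"
    and f :: "real^'n \<Rightarrow> real^'k \<Rightarrow> real"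
    and d :: "real^'n \<Rightarrow> real^'n \<Rightarrow> real"
    and \<epsilon> :: real
    and xopt :: "real^'n"
  assumes "closed U" and "\<exists>\<xi>\<in>U. \<exists>\<eta>\<in>U. \<xi> \<noteq> \<eta>"
    and "finite U" and "card U \<ge> CARD('n) + 1"
    and "\<And>\<xi>. \<xi> \<in> U \<Longrightarrow> continuous_on UNIV (\<lambda>x. F x \<xi>)"
    and "\<And>\<xi>. \<xi> \<in> U \<Longrightarrow> continuous_on UNIV (\<lambda>x. f x \<xi>)"
    and "\<And>\<xi> i. \<xi> \<in> U \<Longrightarrow> quasiconvex_on UNIV (\<lambda>x. F x \<xi> $ i)"
    and "\<And>\<xi>. \<xi> \<in> U \<Longrightarrow> quasiconvex_on UNIV (\<lambda>x. f x \<xi>)"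
    and "Metric_space UNIV d"
    and "convex_on UNIV (\<lambda>(x, y). d x y)"
    and "\<bar>opt_recovery_cost UNIV F f d \<epsilon> U\<bar> \<noteq> \<infinity>"
    and "is_arg_min (\<lambda>x. recovery_cost UNIV F f d \<epsilon> x U) (\<lambda>x. x \<in> UNIV) xopt"
  shows "\<exists>V \<subseteq> U. 2 \<le> card V \<and> card V \<le> CARD('n) + 1 \<and>
           opt_recovery_cost UNIV F f d \<epsilon> U = recovery_cost UNIV F f d \<epsilon> xopt U \<and>
           recovery_cost UNIV F f d \<epsilon> xopt U = recovery_cost UNIV F f d \<epsilon> xopt V \<and>
           recovery_cost UNIV F f d \<epsilon> xopt V = opt_recovery_cost UNIV F f d \<epsilon> V"
proof -
  let ?R = "\<lambda>x V. recovery_cost UNIV F f d \<epsilon> x V"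
  define S where "S \<xi> = {x. dist_to_set d x (good_set UNIV F f \<epsilon> \<xi>) < ?R xopt U}" for \<xi>
  have min: "?R xopt U \<le> ?R x U" for x
    using assms(12) by (auto simp: is_arg_min_def not_less)
  have opt: "opt_recovery_cost UNIV F f d \<epsilon> U = ?R xopt U"
    unfolding opt_recovery_cost_def using min by (intro antisym INF_lower INF_greatest) auto
  have conv: "convex (S \<xi>)" if "\<xi> \<in> U" for \<xi>
    unfolding S_def using that assms(7,8,10)
    by (intro convex_dist_to_set_less convex_good_set) auto
  have empty: "(\<Inter>\<xi>\<in>U. S \<xi>) = {}"
  proof (rule equals0I)
    fix x
    assume "x \<in> (\<Inter>\<xi>\<in>U. S \<xi>)"
    \<comment> \<open>As \<open>U\<close> is finite and nonempty, the supremum is a maximum, so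
      strictness in every scenario survives.\<close>
    then have "?R x U < ?R xopt U"
      using assms(2,3) unfolding recovery_cost_def S_def
      by (subst finite_Sup_less_iff) auto
    then show False
      using min[of x] by simp
  qed
  obtain V where V: "V \<subseteq> U" "card V = CARD('n) + 1" "(\<Inter>\<xi>\<in>V. S \<xi>) = {}"
  proof (rule helly_indexed[OF assms(3) _ conv empty])
    show "DIM(real^'n) + 1 \<le> card U"
      using assms(4) by simp
  qed simp_all
  have lower: "?R xopt U \<le> ?R x V" for x
  proof -
    \<comment> \<open>A single scenario of \<open>V\<close> whose set misses \<open>x\<close>
      already forces the cost up to the optimal value.\<close>
    obtain \<xi> where "\<xi> \<in> V" "x \<notin> S \<xi>"
      using V(3) by blast
    then show ?thesis
      unfolding S_def recovery_cost_def by (auto intro: SUP_upper2)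
  qed
  have upper: "?R xopt V \<le> ?R xopt U"
    unfolding recovery_cost_def using V(1) by (rule SUP_subset_mono) simp
  have eq: "?R xopt U = ?R xopt V"
    using lower upper by (rule antisym)
  have "opt_recovery_cost UNIV F f d \<epsilon> V = ?R xopt V"
    unfolding opt_recovery_cost_def using lower eq by (intro antisym INF_lower INF_greatest) auto
  \<comment> \<open>The size is exactly \<open>CARD('n) + 1\<close>, and an index type has at least
    one element.\<close>
  moreover have "2 \<le> card V"
    using V(2) zero_less_card_finite[where 'a = 'n] by linarith
  ultimately show ?thesis
    using V(1,2) opt eq by auto
qed

end
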